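(* Let $n\ge2$, let $d\ge1$ be an integer, and let $f:\mathbb{R}^n\to\mathbb{R}$ be twice continuously differentiable and positively homogeneous of degree $d$, i.e., $f(\lambda\mathbf{x})=\lambda^d f(\mathbf{x})$ for all $\lambda>0$ and all $\mathbf{x}\in\mathbb{R}^n$. Let $\mathbf{x}^*\in\mathbb{S}^{n-1}$. (a) $\mathbf{x}^*$ satisfies (FONC) if and only if $\|\nabla f(\mathbf{x}^* )\|^2=d^2f(\mathbf{x}^* )^2$. (b) Suppose $d>2$ and $\mathbf{x}^*$ satisfies (FONC). Then $\mathbf{x}^*$ satisfies (SONC) if and only if $$\lambda_1(\nabla^2 f(\mathbf{x}^* ))\ge d\,f(\mathbf{x}^* )\ \text{ if } f(\mathbf{x}^* )\ge0,\qquad \lambda_2(\nabla^2 f(\mathbf{x}^* ))\ge d\,f(\mathbf{x}^* )\ \text{ if } f(\mathbf{x}^* )<0.$$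
   Context: $\mathbb{S}^{n-1}$ is the Euclidean unit sphere in $\mathbb{R}^n$. For a real symmetric matrix $A$, $\lambda_1(A)\le\lambda_2(A)\le\cdots\le\lambda_n(A)$ are its eigenvalues in increasing order. A point $\mathbf{x}^*\in\mathbb{S}^{n-1}$ satisfies (FONC) if there is $\lambda^*\in\mathbb{R}$ with $\nabla f(\mathbf{x}^* )+2\lambda^*\mathbf{x}^*=0$. A point $\mathbf{x}^*$ satisfying (FONC), with this $\lambda^*$, satisfies (SONC) if $\mathbf{u}^T\nabla^2 f(\mathbf{x}^* )\mathbf{u}+2\lambda^*\ge 0$ for all unit vectors $\mathbf{u}\in\mathbb{R}^n$ with $\mathbf{u}^T\mathbf{x}^*=0$. *)

theory Defs
  imports "HOL-Analysis.Analysis" "HOL-Computational_Algebra.Computational_Algebra"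
begin

definition gradient :: "('a::real_inner \<Rightarrow> real) \<Rightarrow> 'a \<Rightarrow> 'a" where
  "gradient f x = (THE D. GDERIV f x :> D)"

definition hessian :: "(real^'n \<Rightarrow> real) \<Rightarrow> real^'n \<Rightarrow> real^'n^'n" where
  "hessian f x = jacobian (gradient f) (at x)"

definition twice_continuously_differentiable :: "(real^'n \<Rightarrow> real) \<Rightarrow> bool" where
  "twice_continuously_differentiable f \<longleftrightarrow>
     (\<forall>x. f differentiable (at x)) \<and>
     (\<forall>x. gradient f differentiable (at x)) \<and>
     continuous_on UNIV (hessian f)"

definition positively_homogeneous :: "nat \<Rightarrow> ('a::real_vector \<Rightarrow> real) \<Rightarrow> bool" where
  "positively_homogeneous d f \<longleftrightarrow> (\<forall>c>0. \<forall>x. f (c *\<^sub>R x) = c ^ d * f x)"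

definition charpoly :: "'a::comm_ring_1^'n^'n \<Rightarrow> 'a poly" where
  "charpoly A = det (mat [:0, 1:] - map_matrix (\<lambda>a. [:a:]) A)"

(* sorted_eigenvalue k A is the k-th smallest eigenvalue, counted with algebraic multiplicity;
   k starts at 1. It is meaningful only if A has at least k real eigenvalues, e.g. for symmetric A
   and k at most the dimension. *)
definition sorted_eigenvalue :: "nat \<Rightarrow> real^'n^'n \<Rightarrow> real" where
  "sorted_eigenvalue k A = sorted_list_of_multiset (proots (charpoly A)) ! (k - 1)"

definition FONC_multiplier :: "('a::real_inner \<Rightarrow> real) \<Rightarrow> 'a \<Rightarrow> real \<Rightarrow> bool" where
  "FONC_multiplier f x l \<longleftrightarrow> gradient f x + (2 * l) *\<^sub>R x = 0"

definition FONC :: "('a::real_inner \<Rightarrow> real) \<Rightarrow> 'a \<Rightarrow> bool" where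
  "FONC f x \<longleftrightarrow> (\<exists>l. FONC_multiplier f x l)"

(* The multiplier l is unique for x on the unit sphere, so the existential quantifier
   refers to the multiplier of FONC. *)
definition SONC :: "(real^'n \<Rightarrow> real) \<Rightarrow> real^'n \<Rightarrow> bool" where
  "SONC f x \<longleftrightarrow>
     (\<exists>l. FONC_multiplier f x l \<and>
          (\<forall>u. norm u = 1 \<and> u \<bullet> x = 0 \<longrightarrow> u \<bullet> (hessian f x *v u) + 2 * l \<ge> 0))"

end

theory Submission
  imports Defs
begin

text \<open>
  Write c = d f(x), g for the gradient and H for the Hessian of f at x. Everything rests on two
  consequences of homogeneity. Euler's identity (\<open>euler_homogeneous\<close>) gives g \<bullet> x = c.
  Differentiating it once more, and using the symmetry of H, gives H x = (d - 1) g
  (\<open>second_derivative_homogeneous\<close>).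

  For (a), (FONC) says that g is parallel to x, and by Euler's identity the factor can only be c.
  Since |g - c x|^2 = |g|^2 - c^2 on the sphere, this is the equality case of Cauchy-Schwarz,
  |g|^2 = c^2. The multiplier is then -c/2.

  For (b), (FONC) turns H x = (d - 1) g into H x = (d - 1) c x, so x is itself an eigenvector of H
  and can be completed to an orthonormal eigenbasis
  (\<open>symmetric_matrix_orthonormal_eigenbasis\<close>). Expanding in this basis, (SONC) says that every
  eigenvalue belonging to a basis vector other than x is at least c. It remains to see where the
  eigenvalue (d - 1) c of x stands. If f(x) \<ge> 0, it is at least c, so that the condition
  is that all eigenvalues, or the smallest one, are at least c. If f(x) < 0, then d > 2 makes it
  strictly smaller than c, so that the second smallest eigenvalue is at least c exactly when all
  the others are. The eigenvalues in the sense
  of sorted roots of the characteristic polynomial are those of the eigenbasis by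
  \<open>proots_charpoly_orthonormal_eigenbasis\<close>.
\<close>

section \<open>Gradient and Hessian as derivatives\<close>

lemma GDERIV_gradient:
  fixes f :: "'a::euclidean_space \<Rightarrow> real"
  assumes "f differentiable (at x)"
  shows "GDERIV f x :> gradient f x"
proof -
  obtain f' where f': "(f has_derivative f') (at x)"
    using assms unfolding differentiable_def by blast
  then interpret bounded_linear f'
    by (rule has_derivative_bounded_linear)
  have "f' h = inner h (\<Sum>b\<in>Basis. f' b *\<^sub>R b)" for h
  proof -
    have "f' h = f' (\<Sum>b\<in>Basis. inner h b *\<^sub>R b)"
      by (simp add: euclidean_representation)
    also have "\<dots> = (\<Sum>b\<in>Basis. inner h b * f' b)"
      by (simp add: sum scaleR)
    also have "\<dots> = inner h (\<Sum>b\<in>Basis. f' b *\<^sub>R b)"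
      by (simp add: inner_sum_right mult.commute)
    finally show ?thesis .
  qed
  then have ex: "GDERIV f x :> (\<Sum>b\<in>Basis. f' b *\<^sub>R b)"
    using f' unfolding gderiv_def by (metis (no_types, lifting) ext)
  have uniq: "D = E" if "GDERIV f x :> D" "GDERIV f x :> E" for D E
  proof -
    have "(\<lambda>h. inner h D) = (\<lambda>h. inner h E)"
      using that unfolding gderiv_def by (rule has_derivative_unique)
    then show ?thesis
      by (metis vector_eq_ldot)
  qed
  show ?thesis
    unfolding gradient_def using ex by (rule theI[of "\<lambda>D. GDERIV f x :> D"]) (rule uniq[OF _ ex])
qed

lemma has_derivative_gradient:
  fixes f :: "'a::euclidean_space \<Rightarrow> real"
  assumes "f differentiable (at x)"
  shows "(f has_derivative (\<lambda>h. h \<bullet> gradient f x)) (at x)"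
  using GDERIV_gradient[OF assms] by (simp add: gderiv_def)

lemma gradient_has_derivative_hessian:
  fixes f :: "real^'n \<Rightarrow> real"
  assumes "gradient f differentiable (at x)"
  shows "(gradient f has_derivative (\<lambda>h. hessian f x *v h)) (at x)"
  using assms unfolding hessian_def by (simp add: jacobian_works)

section \<open>Symmetry of the second derivative\<close>

text \<open>
  The mixed second difference of f is symmetric in u and v, whereas the mean value theorem, applied
  in the direction u only, identifies it up to o(t^2) with t^2 times u \<bullet> H v. Hence
  differentiability of the gradient at the single point x yields the symmetry of H.
\<close>

lemma second_difference_estimate:
  fixes f :: "'a::euclidean_space \<Rightarrow> real" and g :: "'a \<Rightarrow> 'a"
  assumes f: "\<And>y. (f has_derivative (\<lambda>h. h \<bullet> g y)) (at y)"
    and "linear H"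
    and H: "\<And>y. norm y < \<delta> \<Longrightarrow> norm (g (x + y) - g x - H y) \<le> e * norm y"
    and t: "0 < t" "t * (norm u + norm v) < \<delta>" and e: "0 \<le> e"
  shows "\<bar>f (x + t *\<^sub>R u + t *\<^sub>R v) - f (x + t *\<^sub>R u) - f (x + t *\<^sub>R v) + f x - t\<^sup>2 * (u \<bullet> H v)\<bar>
    \<le> e * t\<^sup>2 * (norm u * (2 * norm u + norm v))"
proof -
  interpret H: linear H by fact
  define \<phi> where "\<phi> s = f (x + s *\<^sub>R u + t *\<^sub>R v) - f (x + s *\<^sub>R u)" for s
  have deriv: "(\<phi> has_real_derivative u \<bullet> (g (x + s *\<^sub>R u + t *\<^sub>R v) - g (x + s *\<^sub>R u))) (at s)" for s
  proof -
    have "(\<phi> has_derivative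
        (\<lambda>h. (h *\<^sub>R u) \<bullet> g (x + s *\<^sub>R u + t *\<^sub>R v) - (h *\<^sub>R u) \<bullet> g (x + s *\<^sub>R u))) (at s)"
      unfolding \<phi>_def
      by (rule has_derivative_diff; rule has_derivative_compose[OF _ f, where f = "\<lambda>s. _ s"])
         (auto intro!: derivative_eq_intros)
    then show ?thesis
      by (rule has_derivative_imp_has_field_derivative) (simp add: algebra_simps)
  qed
  obtain \<xi> where \<xi>: "0 < \<xi>" "\<xi> < t"
    and mvt: "\<phi> t - \<phi> 0 = (t - 0) * (u \<bullet> (g (x + \<xi> *\<^sub>R u + t *\<^sub>R v) - g (x + \<xi> *\<^sub>R u)))"
    using MVT2[of 0 t \<phi>, OF t(1) deriv] by blast
  define r where "r y = g (x + y) - g x - H y" for y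
  let ?y = "\<xi> *\<^sub>R u + t *\<^sub>R v" and ?z = "\<xi> *\<^sub>R u"
  have z: "norm ?z \<le> t * norm u"
    using \<xi> by (simp add: mult_right_mono)
  have y: "norm ?y \<le> t * norm u + t * norm v"
    using z t(1) by (intro norm_triangle_le) simp
  have "0 \<le> t * norm v" using t by simp
  have "norm ?y < \<delta>" "norm ?z < \<delta>"
    using y z t(2) \<open>0 \<le> t * norm v\<close> by (simp_all only: distrib_left)
  then have "norm (r ?y) \<le> e * (t * norm u + t * norm v)" "norm (r ?z) \<le> e * (t * norm u)"
    using H[of ?y] H[of ?z] mult_left_mono[OF y e] mult_left_mono[OF z e]
    unfolding r_def by linarith+
  then have r: "norm (r ?y - r ?z) \<le> e * t * (2 * norm u + norm v)"
    using norm_triangle_ineq4[of "r ?y" "r ?z"] by (simp add: algebra_simps)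
  have "g (x + \<xi> *\<^sub>R u + t *\<^sub>R v) - g (x + \<xi> *\<^sub>R u) = t *\<^sub>R H v + (r ?y - r ?z)"
    by (simp add: r_def H.add H.scaleR add.assoc)
  then have "\<phi> t - \<phi> 0 - t\<^sup>2 * (u \<bullet> H v) = t * (u \<bullet> (r ?y - r ?z))"
    unfolding mvt by (simp only: inner_add_right inner_scaleR_right) (simp add: power2_eq_square algebra_simps)
  moreover have "\<bar>u \<bullet> (r ?y - r ?z)\<bar> \<le> norm u * (e * t * (2 * norm u + norm v))"
    using Cauchy_Schwarz_ineq2[of u "r ?y - r ?z"] mult_left_mono[OF r norm_ge_zero[of u]]
    by linarith
  then have "\<bar>t * (u \<bullet> (r ?y - r ?z))\<bar> \<le> t * (norm u * (e * t * (2 * norm u + norm v)))"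
    using t(1) by (simp add: abs_mult)
  moreover have "t * (norm u * (e * t * (2 * norm u + norm v)))
      = e * t\<^sup>2 * (norm u * (2 * norm u + norm v))"
    by (simp add: power2_eq_square)
  moreover have "f (x + t *\<^sub>R u + t *\<^sub>R v) - f (x + t *\<^sub>R u) - f (x + t *\<^sub>R v) + f x = \<phi> t - \<phi> 0"
    by (simp add: \<phi>_def)
  ultimately show ?thesis by simp
qed

lemma second_derivative_symmetric:
  fixes f :: "'a::euclidean_space \<Rightarrow> real" and g :: "'a \<Rightarrow> 'a"
  assumes f: "\<And>y. (f has_derivative (\<lambda>h. h \<bullet> g y)) (at y)"
    and g: "(g has_derivative H) (at x)"
  shows "u \<bullet> H v = v \<bullet> H u"
proof -
  have lin: "linear H" using g by (rule has_derivative_linear)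
  define K where "K = norm u * (2 * norm u + norm v) + norm v * (2 * norm v + norm u)"
  have K: "0 \<le> K" unfolding K_def by simp
  have small: "\<bar>u \<bullet> H v - v \<bullet> H u\<bar> \<le> e * K" if "0 < e" for e
  proof -
    obtain \<delta> where \<delta>: "0 < \<delta>"
      "\<And>y. norm (y - x) < \<delta> \<Longrightarrow> norm (g y - g x - H (y - x)) \<le> e * norm (y - x)"
      using conjunct2[OF g[unfolded has_derivative_at_alt], rule_format, of e] \<open>0 < e\<close> by blast
    have H: "norm (g (x + y) - g x - H y) \<le> e * norm y" if "norm y < \<delta>" for y
      using \<delta>(2)[of "x + y"] that by simp
    define t where "t = \<delta> / (norm u + norm v + 1)"
    have pos: "0 < norm u + norm v + 1"
      by (simp add: add_nonneg_pos)
    have t: "0 < t" unfolding t_def using \<delta>(1) pos by simp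
    have "t * (norm u + norm v + 1) = \<delta>" unfolding t_def using pos by simp
    then have t2: "t * (norm u + norm v) < \<delta>" "t * (norm v + norm u) < \<delta>"
      using t by (simp_all add: algebra_simps)
    have e: "0 \<le> e" using that by simp
    have comm: "x + t *\<^sub>R v + t *\<^sub>R u = x + t *\<^sub>R u + t *\<^sub>R v" by simp
    have "\<bar>t\<^sup>2 * (u \<bullet> H v) - t\<^sup>2 * (v \<bullet> H u)\<bar> \<le> e * t\<^sup>2 * K"
      using second_difference_estimate[OF f lin H t t2(1) e]
        second_difference_estimate[OF f lin H t t2(2) e]
      unfolding K_def comm distrib_left[of "e * t\<^sup>2"] by linarith
    also have "t\<^sup>2 * (u \<bullet> H v) - t\<^sup>2 * (v \<bullet> H u) = t\<^sup>2 * (u \<bullet> H v - v \<bullet> H u)"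
      by (simp add: algebra_simps)
    finally have "t\<^sup>2 * \<bar>u \<bullet> H v - v \<bullet> H u\<bar> \<le> t\<^sup>2 * (e * K)"
      by (simp add: abs_mult mult_ac)
    then show ?thesis using t by simp
  qed
  have "\<bar>u \<bullet> H v - v \<bullet> H u\<bar> \<le> 0"
  proof (rule field_le_epsilon)
    fix e :: real assume "0 < e"
    then have "\<bar>u \<bullet> H v - v \<bullet> H u\<bar> \<le> e / (K + 1) * K"
      using K by (intro small) simp
    also have "\<dots> \<le> e" using K \<open>0 < e\<close> by (simp add: field_simps)
    finally show "\<bar>u \<bullet> H v - v \<bullet> H u\<bar> \<le> 0 + e" by simp
  qed
  then show ?thesis by simp
qed

section \<open>Homogeneous functions\<close>

lemma euler_homogeneous:
  fixes f :: "'a::real_inner \<Rightarrow> real"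
  assumes hom: "positively_homogeneous d f"
    and f: "(f has_derivative (\<lambda>h. h \<bullet> g)) (at x)"
  shows "g \<bullet> x = real d * f x"
proof -
  have "((\<lambda>c. f (c *\<^sub>R x)) has_derivative (\<lambda>h. (h *\<^sub>R x) \<bullet> g)) (at 1)"
    by (rule has_derivative_compose[where f = "\<lambda>c. c *\<^sub>R x" and g = f])
       (use f in \<open>auto intro!: derivative_eq_intros\<close>)
  then have 1: "((\<lambda>c. f (c *\<^sub>R x)) has_real_derivative g \<bullet> x) (at 1)"
    by (rule has_derivative_imp_has_field_derivative) (simp add: inner_commute)
  have "((\<lambda>c. c ^ d * f x) has_real_derivative real d * f x) (at 1)"
    by (auto intro!: derivative_eq_intros)
  then have "((\<lambda>c. f (c *\<^sub>R x)) has_real_derivative real d * f x) (at 1)"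
    by (rule has_field_derivative_transform_within_open[where S = "{0<..}"])
       (use hom in \<open>auto simp: positively_homogeneous_def\<close>)
  with 1 show ?thesis by (rule DERIV_unique)
qed

text \<open>
  Differentiating Euler's identity g(y) \<bullet> y = d f(y) at x in the direction h gives
  g(x) \<bullet> h + H h \<bullet> x = d (g(x) \<bullet> h), and symmetry moves H from h to x.
\<close>

lemma second_derivative_homogeneous:
  fixes f :: "'a::euclidean_space \<Rightarrow> real" and g :: "'a \<Rightarrow> 'a"
  assumes hom: "positively_homogeneous d f"
    and f: "\<And>y. (f has_derivative (\<lambda>h. h \<bullet> g y)) (at y)"
    and g: "(g has_derivative H) (at x)"
  shows "H x = (real d - 1) *\<^sub>R g x"
proof -
  have "h \<bullet> H x = h \<bullet> ((real d - 1) *\<^sub>R g x)" for h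
  proof -
    have "((\<lambda>y. g y \<bullet> y) has_derivative (\<lambda>h. g x \<bullet> h + H h \<bullet> x)) (at x)"
      by (intro has_derivative_inner g has_derivative_ident)
    then have "((\<lambda>y. real d * f y) has_derivative (\<lambda>h. g x \<bullet> h + H h \<bullet> x)) (at x)"
      unfolding euler_homogeneous[OF hom f] .
    moreover have "((\<lambda>y. real d * f y) has_derivative (\<lambda>h. real d * (h \<bullet> g x))) (at x)"
      by (intro has_derivative_mult_right f)
    ultimately have "(\<lambda>h. g x \<bullet> h + H h \<bullet> x) = (\<lambda>h. real d * (h \<bullet> g x))"
      by (rule has_derivative_unique)
    from fun_cong[OF this, of h] have "x \<bullet> H h = (real d - 1) * (h \<bullet> g x)"
      by (simp add: inner_commute algebra_simps)
    then show ?thesis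
      using second_derivative_symmetric[OF f g, of h x] by simp
  qed
  then show ?thesis
    using vector_eq_ldot[of "H x" "(real d - 1) *\<^sub>R g x"] by simp
qed

section \<open>Orthonormal eigenbases of symmetric operators\<close>

text \<open>
  A maximiser v of the Rayleigh quotient on the unit sphere of S is an eigenvector: with \<mu> the
  maximum, the quadratic form q(w) = \<mu> |w|^2 - w \<bullet> T w is nonnegative on S and
  vanishes at v, so its first variation at v vanishes as well.
\<close>

lemma symmetric_operator_eigenvector:
  fixes T :: "'a::euclidean_space \<Rightarrow> 'a"
  assumes lin: "linear T" and sym: "\<And>u v. u \<bullet> T v = v \<bullet> T u"
    and S: "subspace S" "\<And>v. v \<in> S \<Longrightarrow> T v \<in> S" "S \<noteq> {0}"
  obtains v where "v \<in> S" "norm v = 1" "T v = (v \<bullet> T v) *\<^sub>R v"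
proof -
  interpret T: linear T by fact
  let ?K = "S \<inter> sphere 0 1"
  have "compact ?K"
    using closed_subspace[OF S(1)] by (metis Int_commute compact_Int_closed compact_sphere)
  moreover have "?K \<noteq> {}"
  proof -
    obtain w where "w \<in> S" "w \<noteq> 0" using S(3) subspace_0[OF S(1)] by blast
    then have "w /\<^sub>R norm w \<in> ?K" using subspace_scale[OF S(1)] by simp
    then show ?thesis by blast
  qed
  moreover have "continuous_on ?K (\<lambda>v. v \<bullet> T v)"
    by (intro continuous_on_inner continuous_on_id linear_continuous_on linear_conv_bounded_linear[THEN iffD1] lin)
  ultimately obtain v where v: "v \<in> ?K" "\<And>w. w \<in> ?K \<Longrightarrow> w \<bullet> T w \<le> v \<bullet> T v"
    using continuous_attains_sup[of ?K "\<lambda>v. v \<bullet> T v"] by blast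
  define \<mu> where "\<mu> = v \<bullet> T v"
  define q where "q w = \<mu> * (w \<bullet> w) - w \<bullet> T w" for w
  have vS: "v \<in> S" and v1: "v \<bullet> v = 1" using v(1) by (auto simp: dot_square_norm)
  have q: "0 \<le> q w" if "w \<in> S" for w
  proof (cases "w = 0")
    case False
    have "w /\<^sub>R norm w \<in> ?K" using that False subspace_scale[OF S(1)] by simp
    from v(2)[OF this] have "(w \<bullet> T w) / (norm w)\<^sup>2 \<le> \<mu>"
      by (simp add: \<mu>_def T.scaleR power2_eq_square field_simps)
    then show ?thesis
      using False by (simp add: q_def power2_norm_eq_inner[symmetric] field_simps)
  qed (simp add: q_def)
  have crit: "h \<bullet> (\<mu> *\<^sub>R v - T v) = 0" if "h \<in> S" for h
  proof -
    define b where "b = h \<bullet> (\<mu> *\<^sub>R v - T v)"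
    have quad: "0 \<le> 2 * t * b + t\<^sup>2 * q h" for t
    proof -
      have "v + t *\<^sub>R h \<in> S" using vS that S(1) by (simp add: subspace_add subspace_scale)
      then have "0 \<le> q (v + t *\<^sub>R h)" by (rule q)
      also have "q (v + t *\<^sub>R h) = 2 * t * b + t\<^sup>2 * q h"
        using v1 sym[of v h] \<mu>_def
        by (simp add: q_def b_def T.add T.scaleR inner_add_left inner_add_right inner_diff_right
            inner_commute[of h v] power2_eq_square algebra_simps)
      finally show ?thesis .
    qed
    show ?thesis
    proof (rule ccontr)
      assume "h \<bullet> (\<mu> *\<^sub>R v - T v) \<noteq> 0"
      then have b: "b \<noteq> 0" by (simp add: b_def)
      \<comment> \<open>The quadratic polynomial in \<open>quad\<close> is negative at t = - b / c; the summand 1 keeps the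
        denominator positive when q h = 0.\<close>
      define c where "c = q h + 1"
      have c: "c > 0" using q[OF that] by (simp add: c_def)
      have "0 \<le> (2 * (- b / c) * b + (- b / c)\<^sup>2 * q h) * c\<^sup>2"
        using quad[of "- b / c"] by simp
      also have "\<dots> = b\<^sup>2 * (q h - 2 * c)"
        using c by (simp add: power2_eq_square field_simps)
      finally have "0 \<le> q h - 2 * c" using b by (simp add: zero_le_mult_iff)
      then show False using c c_def by linarith
    qed
  qed
  have "\<mu> *\<^sub>R v - T v \<in> S" using vS S by (simp add: subspace_diff subspace_scale)
  from crit[OF this] have "T v = \<mu> *\<^sub>R v" by simp
  with vS v(1) show thesis using that \<mu>_def by auto
qed

text \<open>
  Allowing an invariant subspace in place of the whole space makes the induction on the dimension
  possible, because the orthogonal complement of an eigenvector is again invariant. It also lets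
  the basis be built around a prescribed eigenvector.
\<close>

lemma symmetric_operator_orthonormal_eigenbasis:
  fixes T :: "'a::euclidean_space \<Rightarrow> 'a"
  assumes lin: "linear T" and sym: "\<And>u v. u \<bullet> T v = v \<bullet> T u"
    and "subspace S" "\<And>v. v \<in> S \<Longrightarrow> T v \<in> S"
  shows "\<exists>B. B \<subseteq> S \<and> pairwise orthogonal B \<and> span B = S \<and>
    (\<forall>b\<in>B. norm b = 1 \<and> T b = (b \<bullet> T b) *\<^sub>R b)"
  using assms(3,4)
proof (induction "dim S" arbitrary: S rule: less_induct)
  case less
  show ?case
  proof (cases "S = {0}")
    case True
    then show ?thesis by (intro exI[of _ "{}"]) simp
  next
    case False
    obtain v where v: "v \<in> S" "norm v = 1" "T v = (v \<bullet> T v) *\<^sub>R v"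
      using symmetric_operator_eigenvector[OF lin sym less.prems False] by blast
    define S' where "S' = {y \<in> S. orthogonal v y}"
    have S'_eq: "S' = S \<inter> {y. orthogonal v y}" by (auto simp: S'_def)
    have sub: "subspace S'"
      unfolding S'_eq using less.prems(1) subspace_orthogonal_to_vector[of v]
      by (intro subspace_inter)
    have inv: "T y \<in> S'" if "y \<in> S'" for y
    proof -
      have "v \<bullet> T y = (v \<bullet> T v) * (y \<bullet> v)"
        using sym[of v y] v(3) by (metis inner_scaleR_right)
      then show ?thesis using that less.prems(2) by (simp add: S'_def orthogonal_def inner_commute)
    qed
    have "v \<notin> S'" using v(2) by (auto simp: S'_def orthogonal_def)
    then have "S' \<subset> S" using v(1) by (auto simp: S'_def)
    then have "dim S' < dim S"
      using sub less.prems(1) by (metis dim_psubset span_eq_iff)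
    then obtain B where B: "B \<subseteq> S'" "pairwise orthogonal B" "span B = S'"
      "\<forall>b\<in>B. norm b = 1 \<and> T b = (b \<bullet> T b) *\<^sub>R b"
      using less.hyps[OF _ sub inv] by blast
    have "S \<subseteq> span (insert v B)"
    proof
      fix y assume y: "y \<in> S"
      have "y - (y \<bullet> v) *\<^sub>R v \<in> S'"
        using y v(1,2) less.prems(1)
        by (simp add: S'_def subspace_diff subspace_scale orthogonal_def inner_diff_right
            dot_square_norm inner_commute)
      then show "y \<in> span (insert v B)"
        unfolding span_insert B(3)[symmetric] by blast
    qed
    moreover have sub': "insert v B \<subseteq> S" using v(1) B(1) by (auto simp: S'_def)
    moreover have "pairwise orthogonal (insert v B)"
      using B(1,2) by (auto simp: pairwise_insert S'_def orthogonal_commute)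
    ultimately show ?thesis
      using v B(4) less.prems(1) span_minimal[OF sub' less.prems(1)]
      by (intro exI[of _ "insert v B"]) auto
  qed
qed

lemma symmetric_matrix_orthonormal_eigenbasis:
  fixes A :: "real^'n^'n" and x :: "real^'n"
  assumes sym: "\<And>u v. u \<bullet> (A *v v) = v \<bullet> (A *v u)"
    and x: "norm x = 1" "A *v x = \<nu> *\<^sub>R x"
  obtains q :: "'n \<Rightarrow> real^'n" and \<mu> :: "'n \<Rightarrow> real" and k :: 'n
  where "q k = x" "\<mu> k = \<nu>" "\<And>i. A *v q i = \<mu> i *\<^sub>R q i"
    "\<And>i j. q i \<bullet> q j = (if i = j then 1 else 0)"
proof -
  define S where "S = {y. orthogonal x y}"
  have inv: "A *v y \<in> S" if "y \<in> S" for y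
    using that sym[of x y] x(2) by (simp add: S_def orthogonal_def inner_commute)
  have "subspace S"
    unfolding S_def by (rule subspace_orthogonal_to_vector)
  from symmetric_operator_orthonormal_eigenbasis[OF matrix_vector_mul_linear sym this inv]
  obtain B where B: "B \<subseteq> S" "pairwise orthogonal B" "span B = S"
    "\<forall>b\<in>B. norm b = 1 \<and> A *v b = (b \<bullet> (A *v b)) *\<^sub>R b"
    by blast
  define C where "C = insert x B"
  have eig: "norm b = 1 \<and> A *v b = (b \<bullet> (A *v b)) *\<^sub>R b" if "b \<in> C" for b
    using that B(4) x by (auto simp: C_def dot_square_norm)
  have orth: "pairwise orthogonal C"
    using B(1,2) by (auto simp: C_def S_def pairwise_insert orthogonal_commute)
  have "0 \<notin> C" using eig by force
  with orth have ind: "independent C" by (rule pairwise_orthogonal_independent)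
  have "y \<in> span C" for y
  proof -
    have "y - (y \<bullet> x) *\<^sub>R x \<in> S"
      using x(1) by (simp add: S_def orthogonal_def inner_diff_right dot_square_norm inner_commute)
    then show ?thesis unfolding C_def span_insert B(3)[symmetric] by blast
  qed
  then have "card C = CARD('n)"
    using ind by (metis DIM_cart DIM_real UNIV_eq_I dim_UNIV dim_eq_card mult.right_neutral span_UNIV)
  moreover have "finite C" using ind by (rule independent_imp_finite)
  ultimately obtain q :: "'n \<Rightarrow> real^'n" where q: "bij_betw q UNIV C"
    using finite_same_card_bij[of "UNIV :: 'n set" C] by auto
  then have qC: "q i \<in> C" for i by (auto simp: bij_betw_def)
  obtain k where k: "q k = x" using q by (metis C_def bij_betw_imp_surj_on imageE insertI1)
  show thesis
  proof (rule that[of q k "\<lambda>i. q i \<bullet> (A *v q i)"])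
    show "q k \<bullet> (A *v q k) = \<nu>" using k x by (simp add: dot_square_norm)
    show "A *v q i = (q i \<bullet> (A *v q i)) *\<^sub>R q i" for i using eig[OF qC] by blast
    show "q i \<bullet> q j = (if i = j then 1 else 0)" for i j
    proof (cases "i = j")
      case True
      then show ?thesis using eig[OF qC] by (simp add: dot_square_norm)
    next
      case False
      then have "q i \<noteq> q j" using q by (auto simp: bij_betw_def inj_def)
      then show ?thesis using False orth qC unfolding pairwise_def orthogonal_def by auto
    qed
  qed (rule k)
qed

section \<open>Characteristic polynomials and sorted eigenvalues\<close>

text \<open>
  Similar matrices have the same characteristic polynomial: constant matrices embed
  multiplicatively into matrices of polynomials, so the factor det P can be cancelled there.
\<close>

lemma charpoly_conjugate:
  fixes A D P P' :: "'a::comm_ring_1^'n^'n"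
  assumes "A ** P = P ** D" "P ** P' = mat 1"
  shows "charpoly A = charpoly D"
proof -
  let ?c = "map_matrix (\<lambda>a. [:a:]) :: 'a^'n^'n \<Rightarrow> 'a poly^'n^'n"
  have const_sum: "(\<Sum>i\<in>I. [:h i:]) = [:\<Sum>i\<in>I. h i:]" for I and h :: "'n \<Rightarrow> 'a"
    by (induction I rule: infinite_finite_induct) auto
  have const_mult: "?c X ** ?c Y = ?c (X ** Y)" for X Y
    by (simp add: vec_eq_iff matrix_matrix_mult_def const_sum mult.commute)
  have X_commute: "mat [:0, 1:] ** Y = Y ** mat [:0, 1:]" for Y :: "'a poly^'n^'n"
    by (simp add: vec_eq_iff matrix_matrix_mult_def mat_def if_distrib if_distribR
        sum.delta sum.delta' mult.commute cong: if_cong)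
  have minus_mult: "(Y - Z) ** W = Y ** W - Z ** W" "W ** (Y - Z) = W ** Y - W ** Z"
    for Y Z W :: "'a poly^'n^'n"
    by (simp_all add: vec_eq_iff matrix_matrix_mult_def left_diff_distrib right_diff_distrib sum_subtractf)
  have "?c (mat 1) = mat 1"
    by (simp add: vec_eq_iff mat_def one_pCons)
  then have inv: "det (?c P) * det (?c P') = 1"
    using assms(2) by (metis const_mult det_mul det_I)
  have "(mat [:0, 1:] - ?c A) ** ?c P = mat [:0, 1:] ** ?c P - ?c (A ** P)"
    by (simp add: minus_mult const_mult)
  also have "\<dots> = ?c P ** (mat [:0, 1:] - ?c D)"
    by (simp add: minus_mult const_mult assms(1) X_commute[of "?c P"])
  finally have "det ((mat [:0, 1:] - ?c A) ** ?c P) = det (?c P ** (mat [:0, 1:] - ?c D))"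
    by simp
  then have "charpoly A * det (?c P) = charpoly D * det (?c P)"
    unfolding charpoly_def det_mul by (simp add: mult.commute)
  then have "charpoly A * (det (?c P) * det (?c P')) = charpoly D * (det (?c P) * det (?c P'))"
    by (simp flip: mult.assoc)
  then show ?thesis by (simp add: inv)
qed

lemma proots_charpoly_orthonormal_eigenbasis:
  fixes A :: "real^'n^'n" and q :: "'n \<Rightarrow> real^'n"
  assumes eig: "\<And>i. A *v q i = \<mu> i *\<^sub>R q i"
    and orth: "\<And>i j. q i \<bullet> q j = (if i = j then 1 else 0)"
  shows "proots (charpoly A) = image_mset \<mu> (mset_set UNIV)"
proof -
  define P :: "real^'n^'n" where "P = (\<chi> i j. q j $ i)"
  define D :: "real^'n^'n" where "D = (\<chi> i j. if i = j then \<mu> i else 0)"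
  have "transpose P ** P = mat 1"
    using orth by (simp add: vec_eq_iff matrix_matrix_mult_def transpose_def P_def mat_def inner_vec_def)
  then have inv: "P ** transpose P = mat 1" by (simp add: matrix_left_right_inverse)
  have "A ** P = P ** D"
  proof -
    have "(A ** P) $ i $ j = (P ** D) $ i $ j" for i j
    proof -
      have "(A ** P) $ i $ j = (A *v q j) $ i"
        by (simp add: matrix_matrix_mult_def matrix_vector_mult_def P_def)
      also have "\<dots> = (P ** D) $ i $ j"
        by (simp add: eig matrix_matrix_mult_def P_def D_def if_distrib sum.delta cong: if_cong)
      finally show ?thesis .
    qed
    then show ?thesis by (simp add: vec_eq_iff)
  qed
  then have "charpoly A = charpoly D" using inv by (rule charpoly_conjugate)
  also have "\<dots> = (\<Prod>i\<in>UNIV. [:- \<mu> i, 1:])"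
    unfolding charpoly_def by (subst det_diagonal) (simp_all add: D_def mat_def)
  finally have "proots (charpoly A) = (\<Sum>i\<in>UNIV. {#\<mu> i#})"
    by (simp add: proots_prod)
  also have "\<dots> = image_mset \<mu> (mset_set UNIV)"
    by (simp add: sum_unfold_sum_mset)
  finally show ?thesis .
qed

lemma le_sorted_list_of_multiset_nth_0:
  fixes M :: "'a::linorder multiset"
  assumes "M \<noteq> {#}"
  shows "c \<le> sorted_list_of_multiset M ! 0 \<longleftrightarrow> (\<forall>m\<in>#M. c \<le> m)"
proof -
  obtain y ys where ys: "sorted_list_of_multiset M = y # ys"
    using assms by (metis list.exhaust mset.simps(1) mset_sorted_list_of_multiset)
  have "sorted (y # ys)" using sorted_sorted_list_of_multiset[of M] by (simp add: ys)
  moreover have "set_mset M = set (y # ys)" by (metis set_sorted_list_of_multiset ys)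
  ultimately show ?thesis using ys by auto
qed

text \<open>
  An element a below the threshold c uses up the first place of the sorted list as soon as either
  side of the equivalence holds, and the second entry is then the minimum of M.
\<close>

lemma le_sorted_list_of_multiset_nth_1:
  fixes M :: "'a::linorder multiset"
  assumes "M \<noteq> {#}" "a < c"
  shows "c \<le> sorted_list_of_multiset (add_mset a M) ! 1 \<longleftrightarrow> (\<forall>m\<in>#M. c \<le> m)"
proof -
  let ?L = "sorted_list_of_multiset (add_mset a M)"
  have "2 \<le> length ?L"
    using assms(1) by (metis Suc_le_mono mset_sorted_list_of_multiset nonempty_has_size numeral_2_eq_2
        size_add_mset size_mset Suc_leI)
  then obtain y z zs where L: "?L = y # z # zs"
    by (metis One_nat_def Suc_1 Suc_le_length_iff)
  have sorted: "sorted (y # z # zs)"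
    using sorted_sorted_list_of_multiset[of "add_mset a M"] L by simp
  have M: "add_mset a M = add_mset y (mset (z # zs))"
    by (metis L mset.simps(2) mset_sorted_list_of_multiset)
  have ya: "y = a" if "c \<le> z \<or> (\<forall>m\<in>#M. c \<le> m)"
  proof -
    have "a \<in># add_mset y (mset (z # zs))" using M by (metis union_single_eq_member)
    then have "y \<le> a" "a = y \<or> z \<le> a" using sorted by auto
    moreover have "y = a \<or> y \<in># M" using M by (metis insert_noteq_member)
    ultimately show ?thesis using that assms(2) by force
  qed
  have "set_mset M = set (z # zs)" if "y = a"
  proof -
    have "M = mset (z # zs)" using M that by simp
    then show ?thesis by simp
  qed
  then have "c \<le> z \<longleftrightarrow> (\<forall>m\<in>#M. c \<le> m)"
    using ya sorted by (metis list.set_intros(1) order.trans set_ConsD sorted_simps(2))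
  then show ?thesis using L by simp
qed

section \<open>First- and second-order conditions\<close>

lemma FONC_multiplier_iff:
  assumes "norm x = 1" and euler: "gradient f x \<bullet> x = c"
  shows "FONC_multiplier f x l \<longleftrightarrow> gradient f x = c *\<^sub>R x \<and> 2 * l = - c"
proof
  assume "FONC_multiplier f x l"
  then have g: "gradient f x = - (2 * l) *\<^sub>R x"
    by (simp add: FONC_multiplier_def eq_neg_iff_add_eq_0)
  then have "c = - (2 * l)" using assms by (simp add: dot_square_norm)
  with g show "gradient f x = c *\<^sub>R x \<and> 2 * l = - c" by simp
qed (simp add: FONC_multiplier_def)

theorem mainTheorem4:
  fixes f :: "real^'n \<Rightarrow> real" and d :: nat and x :: "real^'n"
  assumes "CARD('n) \<ge> 2"
    and "d \<ge> 1"
    and "twice_continuously_differentiable f"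
    and "positively_homogeneous d f"
    and "x \<in> sphere 0 1"
  shows "(FONC f x \<longleftrightarrow> (norm (gradient f x))\<^sup>2 = (real d)\<^sup>2 * (f x)\<^sup>2) \<and>
    (d > 2 \<and> FONC f x \<longrightarrow>
      (SONC f x \<longleftrightarrow>
        (f x \<ge> 0 \<longrightarrow> sorted_eigenvalue 1 (hessian f x) \<ge> real d * f x) \<and>
        (f x < 0 \<longrightarrow> sorted_eigenvalue 2 (hessian f x) \<ge> real d * f x)))"
proof -
  define c where "c = real d * f x"
  let ?g = "gradient f x" and ?A = "hessian f x"
  have x: "norm x = 1" using assms(5) by simp
  have f: "(f has_derivative (\<lambda>h. h \<bullet> gradient f y)) (at y)" for y
    using assms(3) by (intro has_derivative_gradient) (simp add: twice_continuously_differentiable_def)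
  have g: "(gradient f has_derivative (\<lambda>h. ?A *v h)) (at x)"
    using assms(3)
    by (intro gradient_has_derivative_hessian) (simp add: twice_continuously_differentiable_def)
  have euler: "?g \<bullet> x = c"
    using euler_homogeneous[OF assms(4) f] by (simp add: c_def)
  note mult = FONC_multiplier_iff[OF x euler]
  have FONC_iff: "FONC f x \<longleftrightarrow> ?g = c *\<^sub>R x"
    unfolding FONC_def mult by (auto intro: exI[of _ "- c / 2"])
  have "(norm (?g - c *\<^sub>R x))\<^sup>2 = (norm ?g)\<^sup>2 - c\<^sup>2"
  proof -
    have "x \<bullet> x = 1" "x \<bullet> ?g = c" using x euler by (simp_all add: norm_eq_1 inner_commute)
    then show ?thesis
      unfolding power2_norm_eq_inner
      using euler by (simp add: inner_diff_left inner_diff_right power2_eq_square)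
  qed
  then have a: "FONC f x \<longleftrightarrow> (norm ?g)\<^sup>2 = (real d)\<^sup>2 * (f x)\<^sup>2"
    unfolding FONC_iff by (auto simp: c_def power_mult_distrib)
  have b: "SONC f x \<longleftrightarrow>
        (f x \<ge> 0 \<longrightarrow> sorted_eigenvalue 1 ?A \<ge> c) \<and> (f x < 0 \<longrightarrow> sorted_eigenvalue 2 ?A \<ge> c)"
    if d: "d > 2" and F: "FONC f x"
  proof -
    define \<nu> where "\<nu> = (real d - 1) * c"
    have "?A *v x = \<nu> *\<^sub>R x"
      using second_derivative_homogeneous[OF assms(4) f g] F by (simp add: FONC_iff \<nu>_def)
    with second_derivative_symmetric[OF f g] x
    obtain q :: "'n \<Rightarrow> real^'n" and \<mu> :: "'n \<Rightarrow> real" and k :: 'n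
      where k: "q k = x" "\<mu> k = \<nu>" and eig: "\<And>i. ?A *v q i = \<mu> i *\<^sub>R q i"
        and orth: "\<And>i j. q i \<bullet> q j = (if i = j then 1 else 0)"
      using symmetric_matrix_orthonormal_eigenbasis[of ?A x \<nu>] by metis
    \<comment> \<open>The spectrum with one copy of the eigenvalue of x taken out; \<nu> may occur in it again.\<close>
    define M where "M = image_mset \<mu> (mset_set (UNIV - {k}))"
    have roots: "proots (charpoly ?A) = add_mset \<nu> M"
      unfolding proots_charpoly_orthonormal_eigenbasis[OF eig orth] M_def k(2)[symmetric]
      by (simp flip: image_mset_add_mset add: mset_set.remove[where x = k])
    have "UNIV - {k} \<noteq> {}"
    proof
      assume "UNIV - {k} = {}"
      then have "CARD('n) \<le> card {k}" by (intro card_mono) auto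
      then show False using assms(1) by simp
    qed
    then have M: "M \<noteq> {#}" by (simp add: M_def mset_set_empty_iff)
    have "SONC f x \<longleftrightarrow> (\<forall>u. norm u = 1 \<and> u \<bullet> x = 0 \<longrightarrow> c \<le> u \<bullet> (?A *v u))"
      unfolding SONC_def mult using F by (auto simp: FONC_iff intro!: exI[of _ "- c / 2"])
    also have "\<dots> \<longleftrightarrow> (\<forall>i. i \<noteq> k \<longrightarrow> c \<le> \<mu> i)"
    proof (intro iffI allI impI)
      fix i assume *: "\<forall>u. norm u = 1 \<and> u \<bullet> x = 0 \<longrightarrow> c \<le> u \<bullet> (?A *v u)" and "i \<noteq> k"
      then have "q i \<bullet> x = 0" using orth[of i k] k by simp
      moreover have "norm (q i) = 1" using orth[of i i] by (simp add: norm_eq_1)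
      ultimately have "c \<le> q i \<bullet> (?A *v q i)" using * by blast
      then show "c \<le> \<mu> i" using orth[of i i] by (simp add: eig)
    next
      fix u assume *: "\<forall>i. i \<noteq> k \<longrightarrow> c \<le> \<mu> i" and u: "norm u = 1 \<and> u \<bullet> x = 0"
      \<comment> \<open>Completeness of the basis: P has orthonormal rows, hence orthonormal columns.\<close>
      define P :: "real^'n^'n" where "P = (\<chi> i. q i)"
      have "P ** transpose P = mat 1"
        using orth by (simp add: vec_eq_iff matrix_matrix_mult_def transpose_def P_def mat_def inner_vec_def)
      then have P: "transpose P ** P = mat 1" by (simp add: matrix_left_right_inverse)
      have expand: "(\<Sum>i\<in>UNIV. (u \<bullet> q i) *\<^sub>R q i) = u"
      proof -
        have "u = transpose P *v (P *v u)" by (simp add: matrix_vector_mul_assoc P)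
        also have "\<dots> = (\<Sum>i\<in>UNIV. (u \<bullet> q i) *\<^sub>R q i)"
          by (simp add: vec_eq_iff matrix_vector_mult_def transpose_def P_def inner_vec_def mult.commute)
        finally show ?thesis by simp
      qed
      have norm: "(\<Sum>i\<in>UNIV. (u \<bullet> q i)\<^sup>2) = 1"
      proof -
        have "u \<bullet> (\<Sum>i\<in>UNIV. (u \<bullet> q i) *\<^sub>R q i) = 1"
          unfolding expand using u by (simp add: dot_square_norm)
        then show ?thesis by (simp add: inner_sum_right power2_eq_square)
      qed
      have "u \<bullet> (?A *v (\<Sum>i\<in>UNIV. (u \<bullet> q i) *\<^sub>R q i)) = (\<Sum>i\<in>UNIV. \<mu> i * (u \<bullet> q i)\<^sup>2)"
        by (simp add: linear_sum[OF matrix_vector_mul_linear] matrix_vector_mult_scaleR eig inner_sum_right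
            power2_eq_square mult_ac)
      then have "u \<bullet> (?A *v u) = (\<Sum>i\<in>UNIV. \<mu> i * (u \<bullet> q i)\<^sup>2)"
        unfolding expand .
      also have "\<dots> \<ge> (\<Sum>i\<in>UNIV. c * (u \<bullet> q i)\<^sup>2)"
      proof (rule sum_mono)
        fix i
        show "c * (u \<bullet> q i)\<^sup>2 \<le> \<mu> i * (u \<bullet> q i)\<^sup>2"
          using * u k by (cases "i = k") (auto intro: mult_right_mono)
      qed
      finally show "c \<le> u \<bullet> (?A *v u)"
        by (simp add: norm flip: sum_distrib_left)
    qed
    also have "\<dots> \<longleftrightarrow> (\<forall>m\<in>#M. c \<le> m)" by (auto simp: M_def)
    finally have S: "SONC f x \<longleftrightarrow> (\<forall>m\<in>#M. c \<le> m)" .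
    have "c \<le> \<nu>" if "f x \<ge> 0"
      using d that mult_right_mono[of 1 "real d - 1" c] by (simp add: \<nu>_def c_def)
    moreover have "\<nu> < c" if "f x < 0"
    proof -
      have "c < 0" using that d by (simp add: c_def mult_pos_neg)
      then show ?thesis using d mult_strict_right_mono_neg[of 1 "real d - 1" c] by (simp add: \<nu>_def)
    qed
    ultimately show ?thesis
      unfolding S sorted_eigenvalue_def roots
      using le_sorted_list_of_multiset_nth_0[of "add_mset \<nu> M" c]
        le_sorted_list_of_multiset_nth_1[OF M, of \<nu> c]
      by (cases "f x \<ge> 0") auto
  qed
  show ?thesis using a b by (simp add: c_def)
qed

end
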